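(* Let $\mathcal{L}:\mathbb{R}^{2\times 3}\to\mathbb{R}^4$ be a linear operator and $y\in\mathbb{R}^4$ such that $$\mathcal{L}^{-1}(y)=\{X(a,b)\mid a,b\in\mathbb{R}\},\quad X(a,b):=\begin{pmatrix}a&1&a+1\\ b+1&b&b+1\end{pmatrix}.$$ Let $X^{(1)}=X(a_1,b_1)$ for $1<a_1$ and $0<b_1<\frac{1}{a_1+\frac{1}{2a_1}}$, and let $X^{(i)}$, $i\ge 2$, be the IRLS-$0$ iterates for $\gamma^{(i)}\equiv 0$, i.e. $$X^{(i)}=\underset{X\in\mathcal{L}^{-1}(y)}{\mathrm{argmin}}\ \big\|\big(X^{(i-1)}(X^{(i-1)})^T\big)^{-1/2}X\big\|_F.$$ Then $$\sigma_1(X^{(i)})\to\infty,\quad\sigma_2(X^{(i)})\to 0\qquad(i\to\infty).$$ The iterate thus diverges, but comes arbitrarily close to the set of rank $1$ matrices. In particular, $X^{(i)}=X(a_i,b_i)$ with $a_{i-1}<a_i$ for $i\ge 2$ and $0<b_i<\frac{1}{a_i+\frac{1}{2a_i}}$ for $i\in\mathbb{N}$, and $(a_i,b_i)\to(\infty,0)$.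
   Context: $\mathcal{L}^{-1}(y)=\{X\mid\mathcal{L}(X)=y\}$; $\sigma_1(X)\ge\sigma_2(X)$ are the singular values of $X\in\mathbb{R}^{2\times 3}$; $\|\cdot\|_F$ is the Frobenius norm. The set $\mathcal{L}^{-1}(y)$ contains no rank deficient matrices, so the iteration is well defined with $\gamma=0$. *)

theory Defs
  imports
    "HOL-Analysis.Analysis"
    "HOL-Computational_Algebra.Polynomial"
begin

text \<open>
  A matrix with \<open>m\<close> rows and \<open>n\<close> columns has type \<open>real ^ 'n ^ 'm\<close>, so \<open>real ^ 3 ^ 2\<close> is the
  space of \<open>2 \<times> 3\<close> matrices.  The library norm on this type is the Frobenius norm:
\<close>

lemma norm_eq_frobenius:
  fixes A :: "real ^ 'n ^ 'm"
  shows "norm A = sqrt (\<Sum>i\<in>UNIV. \<Sum>j\<in>UNIV. (A $ i $ j)\<^sup>2)"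
  by (simp add: norm_vec_def L2_set_def real_sqrt_pow2 sum_nonneg)

definition charpoly :: "'a::comm_ring_1 ^ 'n ^ 'n \<Rightarrow> 'a poly" where
  "charpoly A = det (mat [:0, 1:] - map_matrix (\<lambda>c. [:c:]) A)"

text \<open>
  The singular values of \<open>X\<close> are the square roots of the eigenvalues of \<open>X X\<^sup>T\<close>, counted with
  their multiplicity as roots of the characteristic polynomial and listed in decreasing order.
  For \<open>m\<close> rows this list has length \<open>m\<close>, so the convention is the usual one when \<open>m \<le> n\<close>.
  The index \<open>k\<close> of \<open>singular_value k X\<close> starts at \<open>1\<close>.
\<close>

definition singular_values :: "real ^ 'n ^ 'm \<Rightarrow> real list" where
  "singular_values X =
     rev (sorted_list_of_multiset (image_mset sqrt (proots (charpoly (X ** transpose X)))))"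

definition singular_value :: "nat \<Rightarrow> real ^ 'n ^ 'm \<Rightarrow> real" where
  "singular_value k X = singular_values X ! (k - 1)"

definition pos_semidef :: "real ^ 'n ^ 'n \<Rightarrow> bool" where
  "pos_semidef A \<longleftrightarrow> transpose A = A \<and> (\<forall>x. 0 \<le> x \<bullet> (A *v x))"

text \<open>
  The principal square root is meaningful for positive semidefinite \<open>A\<close>, and \<open>A\<^sup>-\<^sup>1\<^sup>/\<^sup>2\<close> for
  positive definite \<open>A\<close>.
\<close>

definition matrix_sqrt :: "real ^ 'n ^ 'n \<Rightarrow> real ^ 'n ^ 'n" where
  "matrix_sqrt A = (THE B. pos_semidef B \<and> B ** B = A)"

definition matrix_inv_sqrt :: "real ^ 'n ^ 'n \<Rightarrow> real ^ 'n ^ 'n" where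
  "matrix_inv_sqrt A = matrix_inv (matrix_sqrt A)"

definition Xmat :: "real \<Rightarrow> real \<Rightarrow> real ^ 3 ^ 2" where
  "Xmat a b = vector [vector [a, 1, a + 1], vector [b + 1, b, b + 1]]"

text \<open>
  One IRLS-0 step with smoothing parameter \<open>0\<close>.  Note that \<^const>\<open>arg_min\<close> is a Hilbert choice:
  if no minimiser exists, its value is unspecified.
\<close>

definition irls0_step ::
    "(real ^ 'n ^ 'm \<Rightarrow> real ^ 'k) \<Rightarrow> real ^ 'k \<Rightarrow> real ^ 'n ^ 'm \<Rightarrow> real ^ 'n ^ 'm" where
  "irls0_step L y W =
     arg_min (\<lambda>Z. norm (matrix_inv_sqrt (W ** transpose W) ** Z)) (\<lambda>Z. Z \<in> L -` {y})"

end

theory Submission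
  imports Defs
begin

text \<open>
  The weighted problem is a strictly convex quadratic problem in two real unknowns, so one step of
  the iteration is an explicit rational map \<open>(a, b) \<mapsto> (next_a a b, next_b a b)\<close>.  Write \<open>p\<close>, \<open>q\<close>, \<open>r\<close>
  for the entries of the Gram matrix \<open>X X\<^sup>T\<close> of \<open>X = X(a, b)\<close>, so that \<open>p\<close> and \<open>r\<close> are the squared
  norms of the rows, and put \<open>d = p r - q\<^sup>2\<close>, \<open>D = 3 d + q\<^sup>2\<close>.  Then
  \<open>\<parallel>(X X\<^sup>T)\<^sup>-\<^sup>1\<^sup>/\<^sup>2 Z\<parallel>\<^sup>2 = (r \<parallel>z\<^sub>1\<parallel>\<^sup>2 - 2 q z\<^sub>1 \<bullet> z\<^sub>2 + p \<parallel>z\<^sub>2\<parallel>\<^sup>2) / d\<close> for a matrix \<open>Z\<close> with rows \<open>z\<^sub>1\<close>, \<open>z\<^sub>2\<close>,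
  and setting the gradient to zero on the family \<open>X(\<alpha>, \<beta>)\<close> gives
  \<open>\<alpha> = q (p + q) / D - 1/2\<close> and \<open>\<beta> = (q r - 2 d) / D\<close> (\<open>irls0_step_Xmat\<close>).

  The region \<open>1 < a\<close>, \<open>0 < b < 1 / (a + 1/(2a))\<close> is mapped into itself (\<open>trapped_next\<close>).  Its upper
  boundary is the curve \<open>b (2 a\<^sup>2 + 1) = 2 a\<close>.  The decisive observation is that the quantity
  \<open>2 \<alpha> - \<beta> (2 \<alpha>\<^sup>2 + 1)\<close>, whose sign tells on which side of the curve the new point lies, factors:
  up to a positive factor it equals \<open>4 d (p + q)\<^sup>2 - D\<^sup>2\<close>.  This is a polynomial of degree only \<open>4\<close> in
  \<open>b\<close>, and its Bernstein coefficients on the interval \<open>0 \<le> b \<le> 2 a / (2 a\<^sup>2 + 1)\<close> are, after the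
  substitution \<open>a = 1 + u\<close>, polynomials in \<open>u\<close> with positive coefficients.  Positivity on the region
  follows.  The same method shows that \<open>a\<close> grows by at least \<open>(a - 1) / (152 a\<^sup>3)\<close> in each step
  (\<open>next_a_ge\<close>), which forces \<open>a \<rightarrow> \<infinity>\<close>.

  The region lies below the hyperbola \<open>a b = 1\<close>; hence \<open>b \<rightarrow> 0\<close> and \<open>d \<le> 9\<close>, whereas \<open>p \<ge> a\<^sup>2\<close>.  Since \<open>\<sigma>\<^sub>1\<^sup>2\<close> is at least
  half the trace \<open>p + r\<close> and \<open>\<sigma>\<^sub>1\<^sup>2 \<sigma>\<^sub>2\<^sup>2 = d\<close>, this gives \<open>\<sigma>\<^sub>1 \<ge> a\<close> and \<open>\<sigma>\<^sub>2 \<le> 3 / a\<close>.  Replacing the second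
  row by its projection onto the first yields a matrix of rank \<open>1\<close> at distance
  \<open>sqrt (d / p) \<le> 3 / a\<close>.
\<close>

section \<open>Square roots and inverses of two-by-two matrices\<close>

lemma pos_semidef_2_entries:
  fixes B :: "real ^ 2 ^ 2"
  assumes "pos_semidef B"
  shows "B $ 2 $ 1 = B $ 1 $ 2" "0 \<le> B $ 1 $ 1" "0 \<le> B $ 2 $ 2" "0 \<le> det B"
proof -
  have nonneg: "0 \<le> x \<bullet> (B *v x)" for x
    using assms by (simp add: pos_semidef_def)
  have "transpose B $ 1 $ 2 = B $ 1 $ 2"
    using assms by (simp add: pos_semidef_def)
  then show sym: "B $ 2 $ 1 = B $ 1 $ 2"
    by (simp add: transpose_def)
  \<comment> \<open>Every sign condition comes from this quadratic form at a suitable vector; at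
    \<open>(B\<^sub>2\<^sub>2, - B\<^sub>1\<^sub>2)\<close> it takes the value \<open>B\<^sub>2\<^sub>2 det B\<close>.\<close>
  have form: "0 \<le> s * (B $ 1 $ 1 * s + B $ 1 $ 2 * t) + t * (B $ 1 $ 2 * s + B $ 2 $ 2 * t)" for s t
    using nonneg[of "vector [s, t]"]
    by (simp add: inner_vec_def matrix_vector_mult_def sum_2 sym)
  show x: "0 \<le> B $ 1 $ 1" and w: "0 \<le> B $ 2 $ 2"
    using form[of 1 0] form[of 0 1] by simp_all
  show "0 \<le> det B"
  proof (cases "B $ 2 $ 2 = 0")
    case True
    have "0 \<le> - (B $ 1 $ 2 * B $ 1 $ 2)"
    proof (cases "B $ 1 $ 1 = 0")
      case True
      then show ?thesis
        using form[of 1 1] form[of 1 "-1"] \<open>B $ 2 $ 2 = 0\<close> by simp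
    next
      case False
      have "B $ 1 $ 1 * (B $ 1 $ 2 * B $ 1 $ 2) \<le> B $ 1 $ 1 * 0"
        using form[of "- B $ 1 $ 2" "B $ 1 $ 1"] True by (simp add: algebra_simps)
      moreover have "0 < B $ 1 $ 1" using False x by simp
      ultimately show ?thesis by (subst (asm) mult_le_cancel_left_pos) simp_all
    qed
    with True sym show ?thesis by (simp add: det_2)
  next
    case False
    have "0 \<le> B $ 2 $ 2 * det B"
      using form[of "B $ 2 $ 2" "- B $ 1 $ 2"] by (simp add: det_2 sym algebra_simps)
    with False w show ?thesis by (simp add: zero_le_mult_iff)
  qed
qed

lemma pos_semidef_2I:
  fixes B :: "real ^ 2 ^ 2"
  assumes "B $ 2 $ 1 = B $ 1 $ 2" "0 < B $ 1 $ 1" "0 \<le> det B"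
  shows "pos_semidef B"
  unfolding pos_semidef_def
proof (intro conjI allI)
  show "transpose B = B"
    using assms by (simp add: transpose_def vec_eq_iff forall_2)
  fix x :: "real ^ 2"
  have "B $ 1 $ 1 * (x \<bullet> (B *v x)) = (B $ 1 $ 1 * x $ 1 + B $ 1 $ 2 * x $ 2)\<^sup>2 + det B * (x $ 2)\<^sup>2"
    using assms(1) by (simp add: inner_vec_def matrix_vector_mult_def sum_2 det_2 power2_eq_square algebra_simps)
  also have "\<dots> \<ge> 0" using assms by simp
  finally show "0 \<le> x \<bullet> (B *v x)" using assms by (simp add: zero_le_mult_iff)
qed

text \<open>
  By the Cayley-Hamilton identity \<open>B\<^sup>2 - tr B \<cdot> B + det B \<cdot> I = 0\<close>, a square root \<open>B\<close> of \<open>M\<close>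
  satisfies \<open>tr B \<cdot> B = M + det B \<cdot> I\<close>.  If \<open>B\<close> is positive semidefinite, then \<open>det B\<close> is the
  nonnegative root \<open>s\<close> of \<open>det M\<close>, and \<open>tr B\<close> is the nonnegative root of \<open>tr M + 2 s\<close>.  This
  determines \<open>B\<close>, and conversely the formula defines a square root.
\<close>

lemma matrix_sqrt_2:
  fixes M :: "real ^ 2 ^ 2"
  assumes sym: "M $ 2 $ 1 = M $ 1 $ 2" and pos: "0 < M $ 1 $ 1" and det: "0 < det M"
  shows "pos_semidef (matrix_sqrt M)" "matrix_sqrt M ** matrix_sqrt M = M"
proof -
  define s where "s = sqrt (det M)"
  define t where "t = sqrt (M $ 1 $ 1 + M $ 2 $ 2 + 2 * s)"
  have s: "0 < s" "s * s = M $ 1 $ 1 * M $ 2 $ 2 - M $ 1 $ 2 * M $ 1 $ 2"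
    using det by (simp_all add: s_def det_2 sym)
  have "0 < M $ 1 $ 1 * M $ 2 $ 2"
    using det by (simp add: det_2 sym) (smt (verit) zero_le_square)
  then have pos': "0 < M $ 2 $ 2"
    using pos by (simp add: zero_less_mult_iff)
  then have t: "0 < t" "t * t = M $ 1 $ 1 + M $ 2 $ 2 + 2 * s"
    using pos s by (simp_all add: t_def)
  define u where "u = 1 / t"
  have u: "0 < u" "u * t = 1" using t(1) by (simp_all add: u_def)
  then have uu: "u * u * (M $ 1 $ 1 + M $ 2 $ 2 + 2 * s) = 1"
    unfolding t(2)[symmetric] by algebra
  define B :: "real ^ 2 ^ 2" where
    "B = vector [vector [u * (M $ 1 $ 1 + s), u * M $ 1 $ 2], vector [u * M $ 1 $ 2, u * (M $ 2 $ 2 + s)]]"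
  have B: "B $ 1 $ 1 = u * (M $ 1 $ 1 + s)" "B $ 1 $ 2 = u * M $ 1 $ 2"
    "B $ 2 $ 1 = u * M $ 1 $ 2" "B $ 2 $ 2 = u * (M $ 2 $ 2 + s)"
    by (simp_all add: B_def)
  have "det B = s"
    unfolding det_2 B using s(2) uu by algebra
  then have psd: "pos_semidef B"
    using s u pos by (intro pos_semidef_2I) (simp_all add: B add_pos_pos)
  have sq: "B ** B = M"
  proof -
    have "B $ 1 $ 1 * B $ 1 $ 1 + B $ 1 $ 2 * B $ 2 $ 1 = M $ 1 $ 1"
      and "B $ 1 $ 1 * B $ 1 $ 2 + B $ 1 $ 2 * B $ 2 $ 2 = M $ 1 $ 2"
      and "B $ 2 $ 1 * B $ 1 $ 1 + B $ 2 $ 2 * B $ 2 $ 1 = M $ 1 $ 2"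
      and "B $ 2 $ 1 * B $ 1 $ 2 + B $ 2 $ 2 * B $ 2 $ 2 = M $ 2 $ 2"
      unfolding B using s(2) uu by algebra+
    then show ?thesis
      by (simp add: vec_eq_iff forall_2 matrix_matrix_mult_def sum_2 sym)
  qed
  have unique: "C = B" if C: "pos_semidef C" "C ** C = M" for C
  proof -
    note entries = pos_semidef_2_entries[OF C(1)]
    have C_eqs: "C $ 1 $ 1 * C $ 1 $ 1 + C $ 1 $ 2 * C $ 1 $ 2 = M $ 1 $ 1"
      "C $ 1 $ 1 * C $ 1 $ 2 + C $ 1 $ 2 * C $ 2 $ 2 = M $ 1 $ 2"
      "C $ 1 $ 2 * C $ 1 $ 2 + C $ 2 $ 2 * C $ 2 $ 2 = M $ 2 $ 2"
      using entries(1) by (simp_all add: C(2)[symmetric] matrix_matrix_mult_def sum_2)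
    have "(det C)\<^sup>2 = det M"
      by (simp add: C(2)[symmetric] det_mul power2_eq_square)
    then have "det C = s"
      using entries(4) unfolding s_def by (metis real_sqrt_unique)
    then have s': "s = C $ 1 $ 1 * C $ 2 $ 2 - C $ 1 $ 2 * C $ 1 $ 2"
      using entries(1) by (simp add: det_2)
    have "(C $ 1 $ 1 + C $ 2 $ 2)\<^sup>2 = M $ 1 $ 1 + M $ 2 $ 2 + 2 * s"
      unfolding s' C_eqs[symmetric] by algebra
    then have t': "t = C $ 1 $ 1 + C $ 2 $ 2"
      using entries(2,3) unfolding t_def by (metis add_nonneg_nonneg real_sqrt_unique)
    have "C $ 1 $ 1 * t = M $ 1 $ 1 + s" "C $ 1 $ 2 * t = M $ 1 $ 2" "C $ 2 $ 2 * t = M $ 2 $ 2 + s"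
      unfolding t' s' C_eqs[symmetric] by algebra+
    then show ?thesis
      using t(1) entries(1) by (simp add: vec_eq_iff forall_2 B u_def eq_divide_eq)
  qed
  have "matrix_sqrt M = B"
    unfolding matrix_sqrt_def
  proof (rule the_equality)
    show "pos_semidef B \<and> B ** B = M" using psd sq ..
    show "C = B" if "pos_semidef C \<and> C ** C = M" for C
      using that unique by blast
  qed
  with psd sq show "pos_semidef (matrix_sqrt M)" "matrix_sqrt M ** matrix_sqrt M = M"
    by simp_all
qed

lemma matrix_inv_2:
  fixes B :: "real ^ 2 ^ 2"
  assumes "det B \<noteq> 0"
  shows "matrix_inv B = (1 / det B) *\<^sub>R vector [vector [B $ 2 $ 2, - B $ 1 $ 2], vector [- B $ 2 $ 1, B $ 1 $ 1]]"
    (is "_ = ?C")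
proof -
  have C: "B ** ?C = mat 1" "?C ** B = mat 1"
    using assms
    by (simp_all add: vec_eq_iff forall_2 matrix_matrix_mult_def sum_2 mat_def det_2
        diff_divide_distrib[symmetric] mult.commute)
  show ?thesis
    unfolding matrix_inv_def
  proof (rule some_equality)
    fix C' assume C': "B ** C' = mat 1 \<and> C' ** B = mat 1"
    have "C' = C' ** (B ** ?C)" by (simp only: C(1) matrix_mul_rid)
    also have "\<dots> = ?C" using C' by (simp only: matrix_mul_assoc matrix_mul_lid)
    finally show "C' = ?C" .
  qed (use C in auto)
qed

lemma norm_matrix_2_rows:
  fixes Z :: "real ^ 'n ^ 2"
  shows "(norm Z)\<^sup>2 = Z $ 1 \<bullet> Z $ 1 + Z $ 2 \<bullet> Z $ 2"
  by (simp add: power2_norm_eq_inner inner_vec_def[of Z Z] sum_2)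

text \<open>
  The left side is \<open>tr (Z\<^sup>T M\<^sup>-\<^sup>1 Z)\<close>, and \<open>M\<^sup>-\<^sup>1\<close> is the adjugate of \<open>M\<close> divided by \<open>det M\<close>.
\<close>

lemma norm_matrix_inv_sqrt_mult_2:
  fixes M :: "real ^ 2 ^ 2" and Z :: "real ^ 'n ^ 2"
  assumes sym: "M $ 2 $ 1 = M $ 1 $ 2" and pos: "0 < M $ 1 $ 1" and det: "0 < det M"
  shows "(norm (matrix_inv_sqrt M ** Z))\<^sup>2 =
    (M $ 2 $ 2 * (Z $ 1 \<bullet> Z $ 1) - 2 * M $ 1 $ 2 * (Z $ 1 \<bullet> Z $ 2) + M $ 1 $ 1 * (Z $ 2 \<bullet> Z $ 2)) / det M"
proof -
  define B where "B = matrix_sqrt M"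
  note B = matrix_sqrt_2[OF assms, folded B_def]
  note entries = pos_semidef_2_entries[OF B(1)]
  have det_B: "det B * det B = det M"
    by (metis B(2) det_mul)
  then have "det B \<noteq> 0" using det by auto
  define C where "C = matrix_inv_sqrt M"
  have C: "C = (1 / det B) *\<^sub>R vector [vector [B $ 2 $ 2, - B $ 1 $ 2], vector [- B $ 1 $ 2, B $ 1 $ 1]]"
    using matrix_inv_2[OF \<open>det B \<noteq> 0\<close>] entries(1) by (simp add: C_def matrix_inv_sqrt_def B_def)
  have M: "M $ 1 $ 1 = B $ 1 $ 1 * B $ 1 $ 1 + B $ 1 $ 2 * B $ 1 $ 2"
    "M $ 1 $ 2 = B $ 1 $ 1 * B $ 1 $ 2 + B $ 1 $ 2 * B $ 2 $ 2"
    "M $ 2 $ 2 = B $ 1 $ 2 * B $ 1 $ 2 + B $ 2 $ 2 * B $ 2 $ 2"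
    using entries(1) by (simp_all add: B(2)[symmetric] matrix_matrix_mult_def sum_2)
  have row: "(C ** Z) $ i = C $ i $ 1 *\<^sub>R Z $ 1 + C $ i $ 2 *\<^sub>R Z $ 2" for i
    by (simp add: vec_eq_iff matrix_matrix_mult_def sum_2)
  \<comment> \<open>The coefficients are the entries of \<open>C\<^sup>T C = C\<^sup>2 = M\<^sup>-\<^sup>1\<close>.\<close>
  have "(norm (C ** Z))\<^sup>2 =
      (C $ 1 $ 1 * C $ 1 $ 1 + C $ 2 $ 1 * C $ 2 $ 1) * (Z $ 1 \<bullet> Z $ 1)
      + 2 * (C $ 1 $ 1 * C $ 1 $ 2 + C $ 2 $ 1 * C $ 2 $ 2) * (Z $ 1 \<bullet> Z $ 2)
      + (C $ 1 $ 2 * C $ 1 $ 2 + C $ 2 $ 2 * C $ 2 $ 2) * (Z $ 2 \<bullet> Z $ 2)"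
    by (simp add: norm_matrix_2_rows row inner_commute algebra_simps)
  also have "C $ 1 $ 1 * C $ 1 $ 1 + C $ 2 $ 1 * C $ 2 $ 1 = M $ 2 $ 2 / det M"
    by (simp add: C M det_B[symmetric] add_divide_distrib)
  also have "C $ 1 $ 1 * C $ 1 $ 2 + C $ 2 $ 1 * C $ 2 $ 2 = - M $ 1 $ 2 / det M"
    by (simp add: C M det_B[symmetric] add_divide_distrib diff_divide_distrib mult.commute)
  also have "C $ 1 $ 2 * C $ 1 $ 2 + C $ 2 $ 2 * C $ 2 $ 2 = M $ 1 $ 1 / det M"
    by (simp add: C M det_B[symmetric] add_divide_distrib)
  finally show ?thesis
    by (simp add: C_def add_divide_distrib diff_divide_distrib)
qed

section \<open>Singular values and rank of matrices with two rows\<close>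

lemma singular_values_2_rows:
  fixes X :: "real ^ 'n ^ 2"
  assumes sum: "x + y = trace (X ** transpose X)" and prod: "x * y = det (X ** transpose X)"
    and le: "y \<le> x"
  shows "singular_value 1 X = sqrt x" "singular_value 2 X = sqrt y"
proof -
  define M where "M = X ** transpose X"
  have "M $ 1 $ 1 + M $ 2 $ 2 = x + y" "M $ 1 $ 1 * M $ 2 $ 2 - M $ 1 $ 2 * M $ 2 $ 1 = x * y"
    using sum prod by (simp_all add: M_def trace_def sum_2 det_2)
  then have "charpoly M = [:- x, 1:] * [:- y, 1:]"
    by (simp add: charpoly_def det_2 mat_def algebra_simps)
  then have "proots (charpoly M) = {#x, y#}"
    by (simp add: proots_mult add_mset_commute del: mult_pCons_left mult_pCons_right)
  then have "singular_values X = [sqrt x, sqrt y]"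
    using le by (simp add: singular_values_def M_def[symmetric] insort_key_def)
  then show "singular_value 1 X = sqrt x" "singular_value 2 X = sqrt y"
    by (simp_all add: singular_value_def)
qed

lemma rank_parallel_rows:
  fixes v :: "real ^ 'n"
  assumes "v \<noteq> 0"
  shows "rank (vector [v, c *\<^sub>R v] :: real ^ 'n ^ 2) = 1"
proof -
  have "rows (vector [v, c *\<^sub>R v] :: real ^ 'n ^ 2)
      = range (\<lambda>i. (vector [v, c *\<^sub>R v] :: real ^ 'n ^ 2) $ i)"
    by (auto simp: rows_def row_def)
  then have "rows (vector [v, c *\<^sub>R v] :: real ^ 'n ^ 2) = {v, c *\<^sub>R v}"
    by (simp add: UNIV_2)
  moreover have "dim {v, c *\<^sub>R v} = 1"
  proof -
    have "c *\<^sub>R v \<in> span {v}" by (intro span_scale span_base) simp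
    then have "dim {c *\<^sub>R v, v} = dim {v}" by (subst dim_insert) simp
    also have "\<dots> = 1" using assms by (subst dim_insert) simp
    finally show ?thesis by (simp only: insert_commute)
  qed
  ultimately show ?thesis
    by (simp add: row_rank_def)
qed

section \<open>The Gram matrix of the family\<close>

definition gram11 :: "real \<Rightarrow> real" where
  "gram11 a = 2 * a\<^sup>2 + 2 * a + 2"

definition gram12 :: "real \<Rightarrow> real \<Rightarrow> real" where
  "gram12 a b = 2 * a * b + 2 * a + 2 * b + 1"

definition gram22 :: "real \<Rightarrow> real" where
  "gram22 b = 3 * b\<^sup>2 + 4 * b + 2"

definition gram_det :: "real \<Rightarrow> real \<Rightarrow> real" where
  "gram_det a b = gram11 a * gram22 b - (gram12 a b)\<^sup>2"

text \<open>
  The minors of \<open>X(a, b)\<close> are, up to sign, the three squared terms (Cauchy-Binet).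
\<close>

lemma gram_det_sos:
  "gram_det a b = (1 + b - a * b)\<^sup>2 + (b + 1)\<^sup>2 + (1 - a * b)\<^sup>2"
  unfolding gram_det_def gram11_def gram12_def gram22_def by algebra

lemma gram_det_pos: "0 < gram_det a b"
proof (cases "b = -1")
  case True
  then have "gram_det a b = a\<^sup>2 + (1 + a)\<^sup>2"
    by (simp add: gram_det_sos)
  also have "\<dots> = 2 * (a + 1/2)\<^sup>2 + 1/2"
    by (simp add: power2_eq_square algebra_simps)
  also have "\<dots> > 0"
    by (simp add: add_nonneg_pos)
  finally show ?thesis .
next
  case False
  then show ?thesis
    unfolding gram_det_sos by (intro add_pos_nonneg add_nonneg_pos) auto
qed

lemma gram11_pos: "0 < gram11 a"
proof -
  have "gram11 a = a\<^sup>2 + (a + 1)\<^sup>2 + 1"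
    by (simp add: gram11_def power2_eq_square algebra_simps)
  then show ?thesis by (simp add: add_nonneg_pos)
qed

lemma gram22_pos: "0 < gram22 b"
proof -
  have "gram22 b = 3 * (b + 2/3)\<^sup>2 + 2/3"
    by (simp add: gram22_def power2_eq_square algebra_simps)
  then show ?thesis by (simp add: add_nonneg_pos)
qed

lemma Xmat_rows:
  "Xmat a b $ 1 \<bullet> Xmat a b $ 1 = gram11 a"
  "Xmat a b $ 1 \<bullet> Xmat a b $ 2 = gram12 a b"
  "Xmat a b $ 2 \<bullet> Xmat a b $ 2 = gram22 b"
  by (simp_all add: Xmat_def gram11_def gram12_def gram22_def inner_vec_def sum_3
      power2_eq_square algebra_simps)

lemma gram_Xmat:
  fixes a b
  defines "M \<equiv> Xmat a b ** transpose (Xmat a b)"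
  shows "M $ 1 $ 1 = gram11 a" "M $ 1 $ 2 = gram12 a b" "M $ 2 $ 1 = gram12 a b"
    "M $ 2 $ 2 = gram22 b" "det M = gram_det a b" "trace M = gram11 a + gram22 b"
proof -
  have "M $ i $ j = Xmat a b $ i \<bullet> Xmat a b $ j" for i j
    by (simp add: M_def matrix_matrix_mult_def transpose_def inner_vec_def)
  then show M: "M $ 1 $ 1 = gram11 a" "M $ 1 $ 2 = gram12 a b" "M $ 2 $ 1 = gram12 a b"
      "M $ 2 $ 2 = gram22 b"
    by (simp_all add: Xmat_rows inner_commute[of "Xmat a b $ 2" "Xmat a b $ 1"])
  show "det M = gram_det a b" "trace M = gram11 a + gram22 b"
    by (simp_all add: det_2 trace_def sum_2 M gram_det_def power2_eq_square)
qed

section \<open>The iteration as a rational map\<close>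

text \<open>
  The function \<open>gram22 b * gram11 x - 2 * gram12 a b * gram12 x z + gram11 a * gram22 z\<close> of \<open>(x, z)\<close>
  has the Hessian determinant \<open>8 (3 p r - 2 q\<^sup>2)\<close>.  Up to the factor \<open>8\<close> this is the quantity
  below, written so that its positivity is visible.
\<close>

definition hess_det :: "real \<Rightarrow> real \<Rightarrow> real" where
  "hess_det a b = 3 * gram_det a b + (gram12 a b)\<^sup>2"

lemma hess_det_pos: "0 < hess_det a b"
  using gram_det_pos[of a b] by (simp add: hess_det_def add_pos_nonneg)

definition next_a :: "real \<Rightarrow> real \<Rightarrow> real" where
  "next_a a b = gram12 a b * (gram11 a + gram12 a b) / hess_det a b - 1 / 2"

definition next_b :: "real \<Rightarrow> real \<Rightarrow> real" where
  "next_b a b = (gram12 a b * gram22 b - 2 * gram_det a b) / hess_det a b"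

lemma weighted_norm_Xmat:
  "(norm (matrix_inv_sqrt (Xmat a b ** transpose (Xmat a b)) ** Xmat x z))\<^sup>2 =
    (gram22 b * gram11 x - 2 * gram12 a b * gram12 x z + gram11 a * gram22 z) / gram_det a b"
  by (subst norm_matrix_inv_sqrt_mult_2) (simp_all add: gram_Xmat Xmat_rows gram11_pos gram_det_pos)

text \<open>
  The point \<open>(next_a a b, next_b a b)\<close> is the critical point of \<open>f\<close>, so \<open>f\<close> minus its value there
  is a pure quadratic form.  It is multiplied by \<open>r > 0\<close> to complete the square in \<open>x\<close> without division.
\<close>

lemma weighted_norm_complete_square:
  fixes a b x z :: real
  defines "p \<equiv> gram11 a" and "q \<equiv> gram12 a b" and "r \<equiv> gram22 b"
  defines "f \<equiv> \<lambda>x z. r * gram11 x - 2 * q * gram12 x z + p * gram22 z"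
  shows "r * (f x z - f (next_a a b) (next_b a b)) =
    2 * (r * (x - next_a a b) - q * (z - next_b a b))\<^sup>2 + hess_det a b * (z - next_b a b)\<^sup>2"
proof -
  define D where "D = hess_det a b"
  have D: "D = 3 * p * r - 2 * q\<^sup>2" "D \<noteq> 0"
    using hess_det_pos[of a b]
    by (simp_all add: D_def hess_det_def gram_det_def p_def q_def r_def)
  define \<alpha> \<beta> where ab: "\<alpha> = next_a a b" "\<beta> = next_b a b"
  have "\<alpha> = q * (p + q) / D - 1 / 2" "\<beta> = (q * r - 2 * (p * r - q\<^sup>2)) / D"
    by (simp_all add: ab next_a_def next_b_def gram_det_def D_def p_def q_def r_def)
  then have "2 * (D * \<alpha>) = 2 * q * (p + q) - D" "D * \<beta> = q * r - 2 * (p * r - q\<^sup>2)"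
    using D(2) by (simp_all add: field_simps)
  then have \<alpha>: "D * (2 * \<alpha> + 1) = 2 * q * (p + q)" and \<beta>: "D * (\<beta> + 1) = r * (p + q)"
    using D(1) by algebra+
  \<comment> \<open>The two critical point equations of \<open>f\<close>.\<close>
  have "D * (r * (2 * \<alpha> + 1)) = D * (2 * q * (\<beta> + 1))" using \<alpha> \<beta> by algebra
  then have s1: "r * (2 * \<alpha> + 1) = 2 * q * (\<beta> + 1)" using D by simp
  have "D * (p * (3 * \<beta> + 2)) = D * (2 * q * (\<alpha> + 1))" using \<alpha> \<beta> D(1) by algebra
  then have s2: "p * (3 * \<beta> + 2) = 2 * q * (\<alpha> + 1)" using D by simp
  have "f x z - f \<alpha> \<beta> = 2 * r * (x - \<alpha>)\<^sup>2 - 4 * q * ((x - \<alpha>) * (z - \<beta>)) + 3 * p * (z - \<beta>)\<^sup>2"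
    using s1 s2 unfolding f_def gram11_def gram12_def gram22_def by algebra
  then show ?thesis
    unfolding ab[symmetric] D_def[symmetric] D(1) by algebra
qed

lemma irls0_step_Xmat:
  assumes "L -` {y} = {Xmat a b | a b. True}"
  shows "irls0_step L y (Xmat a b) = Xmat (next_a a b) (next_b a b)"
proof -
  let ?g = "\<lambda>Z. norm (matrix_inv_sqrt (Xmat a b ** transpose (Xmat a b)) ** Z)"
  let ?best = "Xmat (next_a a b) (next_b a b)"
  have strict: "?g ?best < ?g (Xmat x z)" if ne: "Xmat x z \<noteq> ?best" for x z
  proof -
    let ?h = "x - next_a a b" and ?k = "z - next_b a b"
    have "?h \<noteq> 0 \<or> ?k \<noteq> 0" using ne by auto
    then have "0 < 2 * (gram22 b * ?h - gram12 a b * ?k)\<^sup>2 + hess_det a b * ?k\<^sup>2"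
      using gram22_pos[of b] hess_det_pos[of a b]
      by (cases "?k = 0") (simp_all add: add_nonneg_pos)
    then have "(?g ?best)\<^sup>2 < (?g (Xmat x z))\<^sup>2"
      unfolding weighted_norm_Xmat weighted_norm_complete_square[symmetric]
      using gram22_pos[of b] gram_det_pos[of a b]
      by (simp add: zero_less_mult_iff divide_strict_right_mono)
    then show ?thesis by (rule power2_less_imp_less) simp
  qed
  have eq: "irls0_step L y (Xmat a b) = arg_min ?g (\<lambda>Z. Z \<in> {Xmat a b | a b. True})"
    by (simp only: irls0_step_def assms)
  show ?thesis
    unfolding eq
  proof (rule arg_minI)
    fix Z assume "Z \<in> {Xmat a b | a b. True}"
    then obtain x z where "Z = Xmat x z" by blast
    then show "\<not> ?g Z < ?g ?best" using strict[of x z] by fastforce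
  next
    fix Z assume "Z \<in> {Xmat a b | a b. True}" "\<forall>W. W \<in> {Xmat a b | a b. True} \<longrightarrow> \<not> ?g W < ?g Z"
    then show "Z = ?best" using strict by blast
  qed blast
qed

section \<open>Polynomial inequalities on the invariant region\<close>

definition trapped :: "real \<Rightarrow> real \<Rightarrow> bool" where
  "trapped a b \<longleftrightarrow> 1 < a \<and> 0 < b \<and> b < 1 / (a + 1 / (2 * a))"

lemma trapped_iff: "trapped a b \<longleftrightarrow> 1 < a \<and> 0 < b \<and> b * (2 * a\<^sup>2 + 1) < 2 * a"
proof (cases "1 < a")
  case True
  then have "a + 1 / (2 * a) = (2 * a\<^sup>2 + 1) / (2 * a)"
    by (simp add: field_simps power2_eq_square)
  moreover have "0 < 2 * a\<^sup>2 + 1"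
    by (simp add: add_nonneg_pos)
  ultimately show ?thesis
    by (simp add: trapped_def pos_less_divide_eq)
qed (simp add: trapped_def)

lemma trapped_mult_less_1:
  assumes "trapped a b"
  shows "0 < a * b" "a * b < 1"
proof -
  show "0 < a * b" using assms by (simp add: trapped_iff)
  have "2 * a * (a * b) + b < 2 * a" 
    using assms by (simp add: trapped_iff power2_eq_square algebra_simps)
  then have "2 * a * (a * b) < 2 * a * 1" using assms unfolding trapped_iff by linarith
  then show "a * b < 1" using assms unfolding trapped_iff by (subst (asm) mult_less_cancel_left_pos) auto
qed

lemma trapped_less_1:
  assumes "trapped a b" shows "b < 1"
proof -
  have "b * 1 \<le> a * b" using assms by (simp add: trapped_iff)
  then show ?thesis using trapped_mult_less_1[OF assms] by simp
qed

lemma gram12_pos: "trapped a b \<Longrightarrow> 0 < gram12 a b"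
  by (simp add: trapped_iff gram12_def add_pos_pos)

lemma gram_det_le:
  assumes "trapped a b"
  shows "gram_det a b \<le> 9"
proof -
  have b: "0 < b" "b < 1" "0 < a * b" "a * b < 1"
    using assms trapped_less_1 trapped_mult_less_1 by (auto simp: trapped_iff)
  have "gram_det a b \<le> 2\<^sup>2 + 2\<^sup>2 + 1\<^sup>2"
    unfolding gram_det_sos using b by (intro add_mono power_mono) linarith+
  then show ?thesis by simp
qed

lemma hess_det_le:
  assumes "trapped a b"
  shows "hess_det a b \<le> 76 * a\<^sup>2"
proof -
  have b: "b < 1" "a * b < 1" "1 < a"
    using assms trapped_less_1 trapped_mult_less_1 by (auto simp: trapped_iff)
  \<comment> \<open>\<open>q < 2 a + 5 < 7 a\<close>, and \<open>76 = 3 \<cdot> 9 + 7\<^sup>2\<close>.\<close>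
  have "(gram12 a b)\<^sup>2 \<le> (7 * a)\<^sup>2"
    using b gram12_pos[OF assms] by (intro power_mono) (auto simp: gram12_def)
  moreover have "1\<^sup>2 \<le> a\<^sup>2" using b by (intro power_mono) auto
  ultimately show ?thesis
    using gram_det_le[OF assms] by (simp add: hess_det_def power_mult_distrib)
qed

text \<open>
  A polynomial is positive on an interval if its coefficients in the Bernstein basis are.  For the
  interval with end points \<open>0\<close> and \<open>m / c\<close>, a multiple of the Bernstein basis consists of the products
  of powers of \<open>b\<close> and \<open>k = m - b c\<close>; replacing \<open>m\<close> by \<open>k + b c\<close> gives the coefficients.
\<close>

lemma bernstein_quadratic_pos:
  fixes e\<^sub>0 e\<^sub>1 e\<^sub>2 m c b :: real
  assumes "0 < b" "b * c < m" "0 < m"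
    and "0 < e\<^sub>0"
    and "0 < 2 * e\<^sub>0 * c + e\<^sub>1 * m"
    and "0 < e\<^sub>0 * c\<^sup>2 + e\<^sub>1 * m * c + e\<^sub>2 * m\<^sup>2"
  shows "0 < e\<^sub>0 + e\<^sub>1 * b + e\<^sub>2 * b\<^sup>2"
proof -
  define k where "k = m - b * c"
  define C\<^sub>1 where "C\<^sub>1 = 2 * e\<^sub>0 * c + e\<^sub>1 * m"
  define C\<^sub>2 where "C\<^sub>2 = e\<^sub>0 * c\<^sup>2 + e\<^sub>1 * m * c + e\<^sub>2 * m\<^sup>2"
  note C_defs = C\<^sub>1_def C\<^sub>2_def
  have pos: "0 < k" "0 < C\<^sub>1" "0 < C\<^sub>2" using assms by (simp_all add: k_def C_defs)
  have "m\<^sup>2 * (e\<^sub>0 + e\<^sub>1 * b + e\<^sub>2 * b\<^sup>2) =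
      e\<^sub>0 * k\<^sup>2 + C\<^sub>1 * (b * k) + C\<^sub>2 * b\<^sup>2"
    unfolding k_def C_defs by algebra
  also have "\<dots> > 0"
    using assms(1,4) pos by (intro add_pos_pos mult_pos_pos zero_less_power)
  finally show ?thesis
    using \<open>0 < m\<close> by (simp add: zero_less_mult_iff)
qed

lemma bernstein_quartic_pos:
  fixes e\<^sub>0 e\<^sub>1 e\<^sub>2 e\<^sub>3 e\<^sub>4 m c b :: real
  assumes "0 < b" "b * c < m" "0 < m"
    and "0 < e\<^sub>0"
    and "0 < 4 * e\<^sub>0 * c + e\<^sub>1 * m"
    and "0 < 6 * e\<^sub>0 * c\<^sup>2 + 3 * e\<^sub>1 * m * c + e\<^sub>2 * m\<^sup>2"
    and "0 < 4 * e\<^sub>0 * c ^ 3 + 3 * e\<^sub>1 * m * c\<^sup>2 + 2 * e\<^sub>2 * m\<^sup>2 * c + e\<^sub>3 * m ^ 3"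
    and "0 < e\<^sub>0 * c ^ 4 + e\<^sub>1 * m * c ^ 3 + e\<^sub>2 * m\<^sup>2 * c\<^sup>2 + e\<^sub>3 * m ^ 3 * c + e\<^sub>4 * m ^ 4"
  shows "0 < e\<^sub>0 + e\<^sub>1 * b + e\<^sub>2 * b\<^sup>2 + e\<^sub>3 * b ^ 3 + e\<^sub>4 * b ^ 4"
proof -
  define k where "k = m - b * c"
  define C\<^sub>1 where "C\<^sub>1 = 4 * e\<^sub>0 * c + e\<^sub>1 * m"
  define C\<^sub>2 where "C\<^sub>2 = 6 * e\<^sub>0 * c\<^sup>2 + 3 * e\<^sub>1 * m * c + e\<^sub>2 * m\<^sup>2"
  define C\<^sub>3 where
    "C\<^sub>3 = 4 * e\<^sub>0 * c ^ 3 + 3 * e\<^sub>1 * m * c\<^sup>2 + 2 * e\<^sub>2 * m\<^sup>2 * c + e\<^sub>3 * m ^ 3"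
  define C\<^sub>4 where
    "C\<^sub>4 = e\<^sub>0 * c ^ 4 + e\<^sub>1 * m * c ^ 3 + e\<^sub>2 * m\<^sup>2 * c\<^sup>2 + e\<^sub>3 * m ^ 3 * c + e\<^sub>4 * m ^ 4"
  note C_defs = C\<^sub>1_def C\<^sub>2_def C\<^sub>3_def C\<^sub>4_def
  have pos: "0 < k" "0 < C\<^sub>1" "0 < C\<^sub>2" "0 < C\<^sub>3" "0 < C\<^sub>4"
    using assms by (simp_all add: k_def C_defs)
  have "m ^ 4 * (e\<^sub>0 + e\<^sub>1 * b + e\<^sub>2 * b\<^sup>2 + e\<^sub>3 * b ^ 3 + e\<^sub>4 * b ^ 4) =
      e\<^sub>0 * k ^ 4 + C\<^sub>1 * (b * k ^ 3) + C\<^sub>2 * (b\<^sup>2 * k\<^sup>2) + C\<^sub>3 * (b ^ 3 * k) + C\<^sub>4 * b ^ 4"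
    unfolding k_def C_defs by algebra
  also have "\<dots> > 0"
    using assms(1,4) pos by (intro add_pos_pos mult_pos_pos zero_less_power)
  finally show ?thesis
    using \<open>0 < m\<close> by (simp add: zero_less_mult_iff)
qed

text \<open>
  The factor of \<open>a\<close> on the right is the numerator of \<open>next_a a b - a\<close> over the denominator
  \<open>2 * hess_det a b\<close>.  Subtracting \<open>a - 1\<close> leaves a quadratic in \<open>b\<close> with positive Bernstein
  coefficients on the region.
\<close>

lemma next_a_growth_numerator:
  assumes "trapped a b"
  shows "a - 1 < a * (2 * gram12 a b * (gram11 a + gram12 a b) - (2 * a + 1) * hess_det a b)"
proof -
  define u where "u = a - 1"
  have u: "0 < u" and a: "a = 1 + u"
    using assms by (auto simp: u_def trapped_iff)
  have "0 < (1 - 5 * a - 4 * a\<^sup>2 + 8 * a ^ 3) + (8 * a\<^sup>2 + 24 * a ^ 3 - 8 * a ^ 4) * b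
     + (- 2 * a - 6 * a\<^sup>2 - 6 * a ^ 3 - 20 * a ^ 4) * b\<^sup>2" (is "0 < ?e0 + ?e1 * b + ?e2 * b\<^sup>2")
  proof (rule bernstein_quadratic_pos[where m = "2 * a" and c = "2 * a\<^sup>2 + 1"])
    have "?e0 = 11 * u + 20 * u ^ 2 + 8 * u ^ 3"
      unfolding a by algebra
    also have "\<dots> > 0" using u by (intro add_pos_pos) simp_all
    finally show "0 < ?e0" .
    have "2 * ?e0 * (2 * a\<^sup>2 + 1) + ?e1 * (2 * a) =
        48 + 226 * u + 384 * u ^ 2 + 300 * u ^ 3 + 112 * u ^ 4 + 16 * u ^ 5"
      unfolding a by algebra
    also have "\<dots> > 0" using u by (intro add_pos_pos) simp_all
    finally show "0 < 2 * ?e0 * (2 * a\<^sup>2 + 1) + ?e1 * (2 * a)" .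
    have "?e0 * (2 * a\<^sup>2 + 1)\<^sup>2 + ?e1 * (2 * a) * (2 * a\<^sup>2 + 1) + ?e2 * (2 * a)\<^sup>2 =
        8 + 51 * u + 100 * u ^ 2 + 84 * u ^ 3 + 32 * u ^ 4 + 4 * u ^ 5"
      unfolding a by algebra
    also have "\<dots> > 0" using u by (intro add_pos_pos) simp_all
    finally show "0 < ?e0 * (2 * a\<^sup>2 + 1)\<^sup>2 + ?e1 * (2 * a) * (2 * a\<^sup>2 + 1) + ?e2 * (2 * a)\<^sup>2" .
  qed (use assms in \<open>simp_all add: trapped_iff\<close>)
  also have "\<dots> = a * (2 * gram12 a b * (gram11 a + gram12 a b) - (2 * a + 1) * hess_det a b) - (a - 1)"
    unfolding hess_det_def gram_det_def gram11_def gram12_def gram22_def by algebra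
  finally show ?thesis by simp
qed

text \<open>
  By the factorisation in \<open>trapped_next\<close>, this inequality says that the next iterate stays below
  the curve \<open>b (2 a\<^sup>2 + 1) = 2 a\<close>.
\<close>

lemma hess_det_squared_less:
  assumes "trapped a b"
  shows "(hess_det a b)\<^sup>2 < 4 * gram_det a b * (gram11 a + gram12 a b)\<^sup>2"
proof -
  define u where "u = a - 1"
  have u: "0 < u" and a: "a = 1 + u"
    using assms by (auto simp: u_def trapped_iff)
  have "0 < (8 + 208 * a + 240 * a ^ 2 + 160 * a ^ 3 + 32 * a ^ 4)
    + (- 32 + 448 * a + 64 * a ^ 2 - 160 * a ^ 3 - 256 * a ^ 4 - 64 * a ^ 5) * b
    + (- 144 + 352 * a - 464 * a ^ 2 - 256 * a ^ 3 - 144 * a ^ 4 + 96 * a ^ 5 + 32 * a ^ 6) * b\<^sup>2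
    + (- 160 + 128 * a - 480 * a ^ 2 - 32 * a ^ 4 + 64 * a ^ 5) * b ^ 3
    + (- 68 - 8 * a - 204 * a ^ 2 - 8 * a ^ 3 - 68 * a ^ 4) * b ^ 4"
    (is "0 < ?e0 + ?e1 * b + ?e2 * b\<^sup>2 + ?e3 * b ^ 3 + ?e4 * b ^ 4")
  proof (rule bernstein_quartic_pos[where m = "2 * a" and c = "2 * a\<^sup>2 + 1"])
    let ?m = "2 * a" and ?c = "2 * a\<^sup>2 + 1"
    have "?e0 = 648 + 1296 * u + 912 * u ^ 2 + 288 * u ^ 3 + 32 * u ^ 4"
      unfolding a by algebra
    also have "\<dots> > 0" using u by (intro add_pos_pos) simp_all
    finally show "0 < ?e0" .
    have "4 * ?e0 * ?c + ?e1 * ?m =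
        7776 + 23424 * u + 29184 * u ^ 2 + 19584 * u ^ 3 + 7488 * u ^ 4 + 1536 * u ^ 5
        + 128 * u ^ 6"
      unfolding a by algebra
    also have "\<dots> > 0" using u by (intro add_pos_pos) simp_all
    finally show "0 < 4 * ?e0 * ?c + ?e1 * ?m" .
    have "6 * ?e0 * ?c\<^sup>2 + 3 * ?e1 * ?m * ?c + ?e2 * ?m\<^sup>2 =
        32880 + 131616 * u + 230944 * u ^ 2 + 233024 * u ^ 3 + 147904 * u ^ 4 + 60288 * u ^ 5
        + 15296 * u ^ 6 + 2176 * u ^ 7 + 128 * u ^ 8"
      unfolding a by algebra
    also have "\<dots> > 0" using u by (intro add_pos_pos) simp_all
    finally show "0 < 6 * ?e0 * ?c\<^sup>2 + 3 * ?e1 * ?m * ?c + ?e2 * ?m\<^sup>2" .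
    have "4 * ?e0 * ?c ^ 3 + 3 * ?e1 * ?m * ?c\<^sup>2 + 2 * ?e2 * ?m\<^sup>2 * ?c + ?e3 * ?m ^ 3 =
        53472 + 263680 * u + 586880 * u ^ 2 + 776064 * u ^ 3 + 673344 * u ^ 4 + 398336 * u ^ 5
        + 161024 * u ^ 6 + 43008 * u ^ 7 + 6912 * u ^ 8 + 512 * u ^ 9"
      unfolding a by algebra
    also have "\<dots> > 0" using u by (intro add_pos_pos) simp_all
    finally show "0 < 4 * ?e0 * ?c ^ 3 + 3 * ?e1 * ?m * ?c\<^sup>2 + 2 * ?e2 * ?m\<^sup>2 * ?c + ?e3 * ?m ^ 3" .
    have "?e0 * ?c ^ 4 + ?e1 * ?m * ?c ^ 3 + ?e2 * ?m\<^sup>2 * ?c\<^sup>2 + ?e3 * ?m ^ 3 * ?c + ?e4 * ?m ^ 4 =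
        16264 + 84432 * u + 198288 * u ^ 2 + 277024 * u ^ 3 + 254112 * u ^ 4 + 158976 * u ^ 5
        + 67968 * u ^ 6 + 19200 * u ^ 7 + 3264 * u ^ 8 + 256 * u ^ 9"
      unfolding a by algebra
    also have "\<dots> > 0" using u by (intro add_pos_pos) simp_all
    finally show "0 < ?e0 * ?c ^ 4 + ?e1 * ?m * ?c ^ 3 + ?e2 * ?m\<^sup>2 * ?c\<^sup>2 + ?e3 * ?m ^ 3 * ?c + ?e4 * ?m ^ 4" .
  qed (use assms in \<open>simp_all add: trapped_iff\<close>)
  also have "\<dots> = 4 * gram_det a b * (gram11 a + gram12 a b)\<^sup>2 - (hess_det a b)\<^sup>2"
    unfolding hess_det_def gram_det_def gram11_def gram12_def gram22_def by algebra
  finally show ?thesis by simp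
qed

section \<open>Dynamics on the invariant region\<close>

lemma next_a_ge:
  assumes "trapped a b"
  shows "a + (a - 1) / (152 * a ^ 3) \<le> next_a a b"
proof -
  let ?D = "hess_det a b"
  let ?g = "2 * gram12 a b * (gram11 a + gram12 a b) - (2 * a + 1) * ?D"
  have a: "1 < a" using assms by (simp add: trapped_iff)
  have "(a - 1) / a \<le> ?g"
    using next_a_growth_numerator[OF assms] a by (simp add: pos_divide_le_eq mult.commute)
  moreover have "next_a a b - a = ?g / (2 * ?D)"
    using hess_det_pos[of a b] unfolding next_a_def by (simp add: field_simps)
  moreover have "(a - 1) / (152 * a ^ 3) = (a - 1) / a / (2 * (76 * a\<^sup>2))"
    by (simp add: power2_eq_square power3_eq_cube)
  moreover have "(a - 1) / a / (2 * (76 * a\<^sup>2)) \<le> (a - 1) / a / (2 * ?D)"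
    using a hess_det_le[OF assms] hess_det_pos[of a b] by (intro divide_left_mono) auto
  moreover have "(a - 1) / a / (2 * ?D) \<le> ?g / (2 * ?D)"
    using \<open>(a - 1) / a \<le> ?g\<close> hess_det_pos[of a b] by (intro divide_right_mono) auto
  ultimately show ?thesis by linarith
qed

lemma next_b_pos:
  assumes "trapped a b"
  shows "0 < next_b a b"
proof -
  have b: "0 < b" "b < 1" "0 < a * b" "a * b < 1" "1 < a"
    using assms trapped_less_1 trapped_mult_less_1 by (auto simp: trapped_iff)
  have "gram12 a b * gram22 b - 2 * gram_det a b =
      4 * (a - 1) + 4 * (a * b) * (1 - a * b) + 16 * (a * b) + 7 * b\<^sup>2 + 18 * (a * b) * b
      + 6 * (a * b) * b\<^sup>2 + 6 * b ^ 3"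
    unfolding gram_det_def gram11_def gram12_def gram22_def by algebra
  also have "\<dots> > 0"
    using b by (intro add_pos_pos mult_pos_pos) simp_all
  finally show ?thesis
    using hess_det_pos by (simp add: next_b_def)
qed

text \<open>
  With \<open>(\<alpha>, \<beta>)\<close> the next point, \<open>2 D\<^sup>3 (2 \<alpha> - \<beta> (2 \<alpha>\<^sup>2 + 1))\<close> factors as
  \<open>q (2 q + 3 r) (4 d (p + q)\<^sup>2 - D\<^sup>2)\<close>.
  The reason is that \<open>\<alpha> + 1/2 = (q/r) (\<beta> + 1)\<close> by the first critical point equation.  This turns
  \<open>2 \<alpha> - \<beta> (2 \<alpha>\<^sup>2 + 1)\<close> into
  \<open>2 (q/r) (\<beta> + 1)\<^sup>2 (1 - (q/r) \<beta>) - (1 + (3/2) \<beta>)\<close>, and both terms contain \<open>2 q + 3 r\<close>: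
  \<open>D (r - q \<beta>) = d (2 q + 3 r)\<close> and \<open>D (2 + 3 \<beta>) = q (2 q + 3 r)\<close>.
\<close>

lemma trapped_next:
  assumes "trapped a b"
  shows "trapped (next_a a b) (next_b a b)"
proof -
  define p q r d D where defs: "p = gram11 a" "q = gram12 a b" "r = gram22 b" "d = gram_det a b"
    "D = hess_det a b"
  have pos: "0 < q" "0 < r" "0 < d" "0 < D"
    using gram12_pos[OF assms] gram22_pos gram_det_pos hess_det_pos by (simp_all add: defs)
  have d: "d = p * r - q\<^sup>2" and D: "D = 3 * d + q\<^sup>2"
    by (simp_all add: defs gram_det_def hess_det_def)
  define \<alpha> \<beta> where ab: "\<alpha> = next_a a b" "\<beta> = next_b a b"
  have \<alpha>: "2 * D * \<alpha> = 2 * q * (p + q) - D" and \<beta>: "D * \<beta> = q * r - 2 * d"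
    using pos by (simp_all add: ab next_a_def next_b_def defs field_simps)
  have "2 * D ^ 3 * (2 * \<alpha> - \<beta> * (2 * \<alpha>\<^sup>2 + 1)) =
      2 * D\<^sup>2 * (2 * D * \<alpha>) - (D * \<beta>) * ((2 * D * \<alpha>)\<^sup>2 + 2 * D\<^sup>2)"
    by algebra
  also have "\<dots> = q * (2 * q + 3 * r) * (4 * d * (p + q)\<^sup>2 - D\<^sup>2)"
    unfolding \<alpha> \<beta> unfolding D d by algebra
  also have "\<dots> > 0"
    using pos hess_det_squared_less[OF assms] by (intro mult_pos_pos) (simp_all add: defs)
  finally have "\<beta> * (2 * \<alpha>\<^sup>2 + 1) < 2 * \<alpha>"
    using pos by (simp add: zero_less_mult_iff)
  moreover have "1 < \<alpha>"
  proof -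
    have "1 < a" using assms by (simp add: trapped_iff)
    moreover have "0 \<le> (a - 1) / (152 * a ^ 3)" using \<open>1 < a\<close> by simp
    ultimately show ?thesis using next_a_ge[OF assms] unfolding ab by linarith
  qed
  ultimately show ?thesis
    using next_b_pos[OF assms] by (simp add: trapped_iff ab)
qed

text \<open>
  The increment may shrink as the sequence grows, but below any level \<open>A\<close> it is bounded away from
  \<open>0\<close>, so the sequence leaves every half-line \<open>{..A}\<close>.
\<close>

lemma filterlim_at_top_if_steps:
  fixes a :: "nat \<Rightarrow> real"
  assumes step: "\<And>A. \<exists>\<delta>>0. \<forall>n. a n \<le> A \<longrightarrow> a n + \<delta> \<le> a (Suc n)"
  shows "filterlim a at_top sequentially"
proof -
  have "a n \<le> a (Suc n)" for n
    using step[of "a n"] by force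
  then have mono: "incseq a" by (rule incseq_SucI)
  have unbounded: "\<exists>n. A < a n" for A
  proof (rule ccontr)
    assume "\<not> (\<exists>n. A < a n)"
    then have A: "a n \<le> A" for n by (simp add: not_less)
    with step[of A] obtain \<delta> where \<delta>: "0 < \<delta>" "\<And>n. a n + \<delta> \<le> a (Suc n)"
      by blast
    have "a 0 + real n * \<delta> \<le> a n" for n
    proof (induction n)
      case (Suc n)
      then show ?case using \<delta>(2)[of n] by (simp add: algebra_simps)
    qed simp
    moreover obtain n where "A - a 0 < real n * \<delta>"
      using reals_Archimedean3[OF \<open>0 < \<delta>\<close>] by blast
    ultimately show False using A[of n] by (smt (verit))
  qed
  show ?thesis
    unfolding filterlim_at_top_dense eventually_sequentially
    using unbounded monoD[OF mono] by (meson less_le_trans)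
qed

section \<open>Singular values and distance to rank one\<close>

lemma singular_values_Xmat:
  assumes "trapped a b"
  shows "a \<le> singular_value 1 (Xmat a b)"
    and "0 \<le> singular_value 2 (Xmat a b)" and "singular_value 2 (Xmat a b) \<le> 3 / a"
proof -
  define t d where "t = gram11 a + gram22 b" and "d = gram_det a b"
  \<comment> \<open>The eigenvalues \<open>x \<ge> y\<close> of the Gram matrix are the roots of \<open>\<lambda>\<^sup>2 - t \<lambda> + d\<close>.\<close>
  define w where "w = sqrt (t\<^sup>2 - 4 * d)"
  have "t\<^sup>2 - 4 * d = (gram11 a - gram22 b)\<^sup>2 + (2 * gram12 a b)\<^sup>2"
    unfolding t_def d_def gram_det_def by algebra
  then have w: "w\<^sup>2 = t\<^sup>2 - 4 * d" "0 \<le> w"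
    by (simp_all add: w_def)
  define x y where "x = (t + w) / 2" and "y = (t - w) / 2"
  have xy: "x + y = t" "x * y = d" "y \<le> x"
    using w by (simp_all add: x_def y_def field_simps power2_eq_square)
  have sv: "singular_value 1 (Xmat a b) = sqrt x" "singular_value 2 (Xmat a b) = sqrt y"
    using singular_values_2_rows[of x y "Xmat a b"] xy
    by (simp_all add: gram_Xmat t_def d_def)
  have a: "1 < a" using assms by (simp add: trapped_iff)
  have "a\<^sup>2 \<le> t / 2"
    using gram22_pos[of b] a by (simp add: t_def gram11_def)
  also have "\<dots> \<le> x" using w by (simp add: x_def)
  finally have x: "a\<^sup>2 \<le> x" .
  then show "a \<le> singular_value 1 (Xmat a b)"
    unfolding sv by (rule real_le_rsqrt)
  have "0 < x" using x a by (smt (verit) zero_less_power)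
  have "0 < d" using gram_det_pos by (simp add: d_def)
  then have "0 < y" using xy(2) \<open>0 < x\<close> by (metis zero_less_mult_pos)
  then show "0 \<le> singular_value 2 (Xmat a b)" by (simp add: sv)
  have "a\<^sup>2 * y \<le> x * y" using x \<open>0 < y\<close> by simp
  also have "\<dots> \<le> 9" using gram_det_le[OF assms] by (simp add: xy d_def)
  finally have "y \<le> (3 / a)\<^sup>2"
    using a by (simp add: power_divide pos_le_divide_eq mult.commute)
  then show "singular_value 2 (Xmat a b) \<le> 3 / a"
    unfolding sv using a by (intro real_le_lsqrt) auto
qed

text \<open>
  The nearest matrix with the same first row \<open>v\<close> and rank \<open>1\<close> has as its second row the orthogonal
  projection \<open>c v\<close> of the second row of \<open>Xmat a b\<close>; its squared distance is \<open>d / p\<close>.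
\<close>

lemma infdist_rank_1_Xmat:
  assumes "trapped a b"
  shows "infdist (Xmat a b) {Z. rank Z = 1} \<le> 3 / a"
proof -
  define v where "v = Xmat a b $ 1"
  define c where "c = gram12 a b / gram11 a"
  define Z :: "real ^ 3 ^ 2" where "Z = vector [v, c *\<^sub>R v]"
  note v = Xmat_rows[of a b, folded v_def]
  have p: "0 < gram11 a" by (rule gram11_pos)
  have a: "1 < a" using assms by (simp add: trapped_iff)
  have "v \<noteq> 0" using v(1) p by auto
  then have "rank Z = 1" by (simp add: Z_def rank_parallel_rows)
  have "(dist (Xmat a b) Z)\<^sup>2 = gram22 b - 2 * c * gram12 a b + c\<^sup>2 * gram11 a"
    unfolding dist_norm norm_matrix_2_rows
    by (simp add: Z_def v_def[symmetric] v inner_commute[of "Xmat a b $ 2" v]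
        power2_eq_square algebra_simps)
  also have "\<dots> = gram_det a b / gram11 a"
    using p by (simp add: c_def gram_det_def field_simps power2_eq_square)
  also have "\<dots> \<le> 9 / a\<^sup>2"
  proof (rule frac_le)
    show "a\<^sup>2 \<le> gram11 a" using a by (simp add: gram11_def)
  qed (use a gram_det_le[OF assms] in auto)
  also have "9 / a\<^sup>2 = (3 / a)\<^sup>2" by (simp add: power_divide)
  finally have "dist (Xmat a b) Z \<le> 3 / a"
    by (rule power2_le_imp_le) (use a in simp)
  then show ?thesis
    using \<open>rank Z = 1\<close> by (intro infdist_le2) auto
qed

section \<open>Divergence of the iteration\<close>

theorem proposition3p12:
  fixes L :: "real ^ 3 ^ 2 \<Rightarrow> real ^ 4"
    and y :: "real ^ 4"
    and a1 b1 :: real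
    and X :: "nat \<Rightarrow> real ^ 3 ^ 2"
  assumes "linear L"
    and "L -` {y} = {Xmat a b | a b. True}"
    and "1 < a1"
    and "0 < b1" and "b1 < 1 / (a1 + 1 / (2 * a1))"
    and "X 1 = Xmat a1 b1"
    and "\<And>i. i \<ge> 2 \<Longrightarrow> X i = irls0_step L y (X (i - 1))"
  shows "filterlim (\<lambda>i. singular_value 1 (X i)) at_top sequentially
    \<and> (\<lambda>i. singular_value 2 (X i)) \<longlonglongrightarrow> 0
    \<and> \<not> convergent X
    \<and> (\<lambda>i. infdist (X i) {Z. rank Z = 1}) \<longlonglongrightarrow> 0
    \<and> (\<exists>a b :: nat \<Rightarrow> real.
          a 1 = a1 \<and> b 1 = b1
        \<and> (\<forall>i\<ge>1. X i = Xmat (a i) (b i))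
        \<and> (\<forall>i\<ge>2. a (i - 1) < a i)
        \<and> (\<forall>i\<ge>1. 0 < b i \<and> b i < 1 / (a i + 1 / (2 * a i)))
        \<and> filterlim a at_top sequentially
        \<and> b \<longlonglongrightarrow> 0)"
proof -
  \<comment> \<open>The iteration starts at index \<open>1\<close>, so the \<open>i\<close>-th iterate is the state after \<open>i - 1\<close> steps.\<close>
  define s where "s n = ((\<lambda>(a, b). (next_a a b, next_b a b)) ^^ n) (a1, b1)" for n
  define a b where "a i = fst (s (i - 1))" and "b i = snd (s (i - 1))" for i
  have init: "a 1 = a1" "b 1 = b1" by (simp_all add: a_def b_def s_def)
  have Suc: "a (Suc i) = next_a (a i) (b i)" "b (Suc i) = next_b (a i) (b i)" if "1 \<le> i" for i
    using that by (cases i; simp add: a_def b_def s_def case_prod_beta)+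
  have trapped: "trapped (a i) (b i)" if "1 \<le> i" for i
    using that
  proof (induction i rule: dec_induct)
    case base
    show ?case unfolding init using assms by (simp add: trapped_def)
  next
    case (step i)
    then show ?case by (simp add: Suc trapped_next)
  qed
  have X: "X i = Xmat (a i) (b i)" if "1 \<le> i" for i
    using that
  proof (induction i rule: dec_induct)
    case base
    show ?case unfolding init by (rule assms)
  next
    case (step i)
    then show ?case
      using assms(7)[of "Suc i"] by (simp add: Suc irls0_step_Xmat[OF assms(2)])
  qed
  have incr: "a (i - 1) < a i" if "2 \<le> i" for i
  proof -
    obtain j where j: "i = Suc j" "1 \<le> j" using \<open>2 \<le> i\<close> by (cases i) auto
    have "1 < a j" using trapped[OF j(2)] by (simp add: trapped_iff)
    then have "0 < (a j - 1) / (152 * a j ^ 3)" by simp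
    then show ?thesis using next_a_ge[OF trapped[OF j(2)]] j by (simp add: Suc)
  qed
  have a_ge: "a1 \<le> a i" if "1 \<le> i" for i
    using that
  proof (induction i rule: dec_induct)
    case (step i)
    then show ?case using incr[of "Suc i"] by simp
  qed (simp only: init)
  have "filterlim (\<lambda>n. a (Suc n)) at_top sequentially"
  proof (rule filterlim_at_top_if_steps)
    fix A
    \<comment> \<open>The step bound \<open>(a - 1) / (152 a\<^sup>3)\<close> of \<open>next_a_ge\<close> is at least \<open>\<delta>\<close> for \<open>a1 \<le> a \<le> A\<close>; the
      maximum keeps \<open>\<delta>\<close> positive also when \<open>A\<close> is not.\<close>
    define \<delta> where "\<delta> = (a1 - 1) / (152 * (max A 1) ^ 3)"
    have "0 < \<delta>" using assms(3) by (simp add: \<delta>_def)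
    moreover have "a (Suc n) + \<delta> \<le> a (Suc (Suc n))" if "a (Suc n) \<le> A" for n
    proof -
      have "\<delta> \<le> (a (Suc n) - 1) / (152 * a (Suc n) ^ 3)"
        unfolding \<delta>_def using assms(3) a_ge[of "Suc n"] that
        by (intro frac_le mult_left_mono power_mono) auto
      then show ?thesis
        using next_a_ge[OF trapped[of "Suc n"]] Suc[of "Suc n"] by simp
    qed
    ultimately show "\<exists>\<delta>>0. \<forall>n. a (Suc n) \<le> A \<longrightarrow> a (Suc n) + \<delta> \<le> a (Suc (Suc n))"
      by blast
  qed
  then have a_lim: "filterlim a at_top sequentially"
    by (simp only: filterlim_sequentially_Suc)
  then have inv_lim: "(\<lambda>i. C / a i) \<longlonglongrightarrow> 0" for C
    by (intro tendsto_divide_0[OF tendsto_const] filterlim_at_top_imp_at_infinity)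
  have ev: "eventually (\<lambda>i. 1 \<le> i) sequentially" by (rule eventually_ge_at_top)
  have b_lim: "b \<longlonglongrightarrow> 0"
  proof (rule tendsto_sandwich[OF _ _ tendsto_const inv_lim[of 1]])
    show "eventually (\<lambda>i. 0 \<le> b i) sequentially"
      using ev by eventually_elim (use trapped in \<open>simp add: trapped_iff less_imp_le\<close>)
    show "eventually (\<lambda>i. b i \<le> 1 / a i) sequentially"
      using ev
    proof eventually_elim
      case (elim i)
      then show ?case
        using trapped_mult_less_1(2)[OF trapped[OF elim]] trapped[OF elim]
        by (simp add: trapped_iff pos_le_divide_eq mult.commute)
    qed
  qed
  have bounds: "a i \<le> singular_value 1 (X i)" "0 \<le> singular_value 2 (X i)"
      "singular_value 2 (X i) \<le> 3 / a i" "infdist (X i) {Z. rank Z = 1} \<le> 3 / a i" if "1 \<le> i" for i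
    unfolding X[OF that] using trapped[OF that] by (rule singular_values_Xmat infdist_rank_1_Xmat)+
  have s1: "filterlim (\<lambda>i. singular_value 1 (X i)) at_top sequentially"
    by (rule filterlim_at_top_mono[OF a_lim eventually_mono[OF ev bounds(1)]])
  have s2: "(\<lambda>i. singular_value 2 (X i)) \<longlonglongrightarrow> 0"
    by (rule tendsto_sandwich[OF eventually_mono[OF ev bounds(2)] eventually_mono[OF ev bounds(3)]
          tendsto_const inv_lim])
  have dist: "(\<lambda>i. infdist (X i) {Z. rank Z = 1}) \<longlonglongrightarrow> 0"
    by (rule tendsto_sandwich[OF always_eventually eventually_mono[OF ev bounds(4)]
          tendsto_const inv_lim]) (simp add: infdist_nonneg)
  have "\<not> convergent X"
  proof
    assume "convergent X"
    then obtain Z where "X \<longlonglongrightarrow> Z" by (auto simp: convergent_def)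
    then have "(\<lambda>i. X i $ 1 $ 1) \<longlonglongrightarrow> Z $ 1 $ 1" by (intro tendsto_vec_nth)
    moreover have "eventually (\<lambda>i. X i $ 1 $ 1 = a i) sequentially"
      using ev by eventually_elim (simp add: X Xmat_def)
    ultimately have "a \<longlonglongrightarrow> Z $ 1 $ 1" by (simp add: tendsto_cong)
    with a_lim show False
      using not_tendsto_and_filterlim_at_infinity[OF sequentially_bot]
        filterlim_at_top_imp_at_infinity by blast
  qed
  moreover have "\<forall>i\<ge>1. 0 < b i \<and> b i < 1 / (a i + 1 / (2 * a i))"
    using trapped by (simp add: trapped_def)
  moreover have "\<forall>i\<ge>1. X i = Xmat (a i) (b i)" "\<forall>i\<ge>2. a (i - 1) < a i"
    using X incr by simp_all
  ultimately show ?thesis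
    using s1 s2 dist init a_lim b_lim by (intro conjI exI[of _ a] exI[of _ b])
qed

end
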